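(* Let $\sigma$ be an integer sequence of length $n$. Then $\Theta(\sigma)\in FP_n$ if and only if $\sigma$ avoids both patterns $101$ and $201$.
   Context: $I_n$ is the set of inversion sequences of length $n$, i.e. integer sequences $\sigma=(\sigma_1,\ldots,\sigma_n)$ with $0\le\sigma_i<i$ for every $1\le i\le n$. For a finite integer sequence $\sigma$ of length $n$, $\Theta(\sigma)$ is the sequence of length $n$ defined by $\Theta(\sigma)_i=\#\{j<i:\sigma_j<\sigma_i\}$. $FP_n=\{\sigma\in I_n:\Theta(\sigma)=\sigma\}$. A sequence $\sigma$ avoids $101$ if there are no indices $a<b<c$ with $\sigma_a=\sigma_c>\sigma_b$; it avoids $201$ if there are no indices $a<b<c$ with $\sigma_a>\sigma_c>\sigma_b$. *)

theory Defs
  imports Main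
begin

text \<open>
  A finite integer sequence \<open>(\<sigma>_1, ..., \<sigma>_n)\<close> is a list of length \<open>n\<close>. List positions start at 0, so
  \<open>\<sigma> ! i\<close> is the entry \<open>\<sigma>_(i+1)\<close>; the bound \<open>\<sigma>_i < i\<close> therefore reads \<open>\<sigma> ! i < int (i + 1)\<close>.
\<close>

definition inversion_sequences :: "nat \<Rightarrow> int list set" where
  "inversion_sequences n =
     {\<sigma>. length \<sigma> = n \<and> (\<forall>i<n. 0 \<le> \<sigma> ! i \<and> \<sigma> ! i < int (i + 1))}"

definition Theta :: "int list \<Rightarrow> int list" where
  "Theta \<sigma> = map (\<lambda>i. int (card {j. j < i \<and> \<sigma> ! j < \<sigma> ! i})) [0..<length \<sigma>]"

definition FP :: "nat \<Rightarrow> int list set" where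
  "FP n = {\<sigma> \<in> inversion_sequences n. Theta \<sigma> = \<sigma>}"

definition avoids_101 :: "int list \<Rightarrow> bool" where
  "avoids_101 \<sigma> \<longleftrightarrow>
     \<not> (\<exists>a b c. a < b \<and> b < c \<and> c < length \<sigma> \<and> \<sigma> ! a = \<sigma> ! c \<and> \<sigma> ! c > \<sigma> ! b)"

definition avoids_201 :: "int list \<Rightarrow> bool" where
  "avoids_201 \<sigma> \<longleftrightarrow>
     \<not> (\<exists>a b c. a < b \<and> b < c \<and> c < length \<sigma> \<and> \<sigma> ! a > \<sigma> ! c \<and> \<sigma> ! c > \<sigma> ! b)"

end

theory Submission
  imports Defs
begin

text \<open>
  Write \<open>S i\<close> for the set of positions left of \<open>i\<close> carrying a smaller value. If \<open>j \<in> S i\<close>, then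
  \<open>S j \<union> {j} \<subseteq> S i\<close>, so \<open>\<Theta>(\<sigma>)\<close> preserves every ascent and \<open>\<Theta>(\<Theta>(\<sigma>)) = \<Theta>(\<sigma>)\<close> says that
  it also preserves every weak descent: \<open>\<sigma>_j \<ge> \<sigma>_i\<close> implies \<open>card (S j) \<ge> card (S i)\<close> for
  \<open>j < i\<close>. Avoidance of both patterns forces \<open>S i \<subseteq> S j\<close> for such a pair. Conversely, for a
  pattern at \<open>a < b < c\<close> take \<open>a\<close> leftmost: all entries before \<open>a\<close> are then smaller than
  \<open>\<sigma>_c\<close>, so \<open>S a \<union> {b} \<subseteq> S c\<close> with \<open>b \<notin> S a\<close>, and the weak descent from \<open>a\<close> to \<open>c\<close> is not preserved.
\<close>

definition smaller_before :: "int list \<Rightarrow> nat \<Rightarrow> nat set" where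
  "smaller_before \<sigma> i = {j. j < i \<and> \<sigma> ! j < \<sigma> ! i}"

lemma mem_smaller_before [simp]: "j \<in> smaller_before \<sigma> i \<longleftrightarrow> j < i \<and> \<sigma> ! j < \<sigma> ! i"
  by (simp add: smaller_before_def)

lemma finite_smaller_before [simp]: "finite (smaller_before \<sigma> i)"
  by (simp add: smaller_before_def)

lemma card_smaller_before_le: "card (smaller_before \<sigma> i) \<le> i"
proof -
  have "smaller_before \<sigma> i \<subseteq> {..<i}"
    by auto
  then show ?thesis
    using card_mono [of "{..<i}"] by fastforce
qed

lemma length_Theta [simp]: "length (Theta \<sigma>) = length \<sigma>"
  by (simp add: Theta_def)

lemma nth_Theta: "i < length \<sigma> \<Longrightarrow> Theta \<sigma> ! i = int (card (smaller_before \<sigma> i))"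
  by (simp add: Theta_def smaller_before_def)

text \<open>Only \<open>i\<close> positions precede position \<open>i\<close>. Membership of
  \<open>Theta \<sigma>\<close> in \<open>FP\<close> thus reduces to the fixed-point
  equation.\<close>

lemma Theta_in_inversion_sequences: "Theta \<sigma> \<in> inversion_sequences (length \<sigma>)"
proof -
  have "int (card (smaller_before \<sigma> i)) < int (i + 1)" for i
    using card_smaller_before_le [of \<sigma> i] by linarith
  then show ?thesis
    by (simp add: inversion_sequences_def nth_Theta)
qed

lemma Theta_less:
  assumes "j < i" "i < length \<sigma>" "\<sigma> ! j < \<sigma> ! i"
  shows "Theta \<sigma> ! j < Theta \<sigma> ! i"
proof -
  have "smaller_before \<sigma> j \<subset> smaller_before \<sigma> i"
    using assms by (auto simp: psubset_eq set_eq_iff)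
  then show ?thesis
    using assms by (simp add: nth_Theta psubset_card_mono)
qed

text \<open>By \<open>Theta_less\<close>, passing to \<open>Theta \<sigma>\<close> can only enlarge
  \<open>smaller_before\<close>. Nested finite sets of equal size coincide, so an entry is fixed
  exactly when no position is added.\<close>

lemma Theta_Theta_eq_iff:
  "Theta (Theta \<sigma>) = Theta \<sigma> \<longleftrightarrow>
     (\<forall>i<length \<sigma>. \<forall>j<i. \<sigma> ! i \<le> \<sigma> ! j \<longrightarrow> Theta \<sigma> ! i \<le> Theta \<sigma> ! j)"
proof -
  have "Theta (Theta \<sigma>) ! i = Theta \<sigma> ! i \<longleftrightarrow>
          (\<forall>j<i. \<sigma> ! i \<le> \<sigma> ! j \<longrightarrow> Theta \<sigma> ! i \<le> Theta \<sigma> ! j)" if i: "i < length \<sigma>" for i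
  proof -
    let ?S = "smaller_before \<sigma> i" and ?T = "smaller_before (Theta \<sigma>) i"
    have sub: "?S \<subseteq> ?T"
      using i by (auto intro: Theta_less)
    have "Theta (Theta \<sigma>) ! i = Theta \<sigma> ! i \<longleftrightarrow> card ?S = card ?T"
      using i by (auto simp: nth_Theta)
    also have "\<dots> \<longleftrightarrow> ?T \<subseteq> ?S"
      using sub card_subset_eq [of ?T ?S] by auto
    also have "\<dots> \<longleftrightarrow> (\<forall>j<i. \<sigma> ! i \<le> \<sigma> ! j \<longrightarrow> Theta \<sigma> ! i \<le> Theta \<sigma> ! j)"
      by (auto simp: subset_iff not_less [symmetric])
    finally show ?thesis .
  qed
  then show ?thesis
    by (simp add: list_eq_iff_nth_eq)
qed

text \<open>Merging the patterns turns the first-to-third comparison into the weak descent of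
  \<open>Theta_Theta_eq_iff\<close>.\<close>

lemma avoids_101_201_iff:
  "avoids_101 \<sigma> \<and> avoids_201 \<sigma> \<longleftrightarrow>
     \<not> (\<exists>a b c. a < b \<and> b < c \<and> c < length \<sigma> \<and> \<sigma> ! c \<le> \<sigma> ! a \<and> \<sigma> ! b < \<sigma> ! c)"
  unfolding avoids_101_def avoids_201_def order_le_less by (auto simp: eq_commute)

lemma Theta_le_if_avoids:
  assumes "avoids_101 \<sigma>" "avoids_201 \<sigma>"
    and "j < i" "i < length \<sigma>" "\<sigma> ! i \<le> \<sigma> ! j"
  shows "Theta \<sigma> ! i \<le> Theta \<sigma> ! j"
proof -
  \<comment> \<open>Otherwise \<open>j < k < i\<close> would carry one of the patterns;
    \<open>k = j\<close> contradicts the weak descent.\<close>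
  have "k < j" if "k < i" "\<sigma> ! k < \<sigma> ! i" for k
  proof (rule ccontr)
    assume "\<not> k < j"
    then have "j < k"
      using that assms(5) by (cases "k = j") auto
    then show False
      using that assms avoids_101_201_iff [of \<sigma>] by blast
  qed
  then have "smaller_before \<sigma> i \<subseteq> smaller_before \<sigma> j"
    using assms(5) by fastforce
  then show ?thesis
    using assms(3,4) by (simp add: nth_Theta card_mono)
qed

lemma Theta_less_if_pattern:
  assumes "a < b" "b < c" "c < length \<sigma>" "\<sigma> ! c \<le> \<sigma> ! a" "\<sigma> ! b < \<sigma> ! c"
  obtains a' where "a' < c" "\<sigma> ! c \<le> \<sigma> ! a'" "Theta \<sigma> ! a' < Theta \<sigma> ! c"
proof -
  \<comment> \<open>The given \<open>a\<close> may fail: earlier values at least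
    \<open>\<sigma> ! c\<close> but below \<open>\<sigma> ! a\<close> count for \<open>a\<close> and
    not for \<open>c\<close>. \<open>LEAST\<close> ranges over all naturals, but \<open>a\<close>
    bounds it, so \<open>a'\<close> is a position of the list.\<close>
  define a' where "a' = (LEAST k. \<sigma> ! c \<le> \<sigma> ! k)"
  have ge: "\<sigma> ! c \<le> \<sigma> ! a'"
    unfolding a'_def using assms(4) by (rule LeastI)
  have "a' \<le> a"
    unfolding a'_def using assms(4) by (rule Least_le)
  then have less: "a' < b" "a' < c"
    using assms by auto
  have "\<sigma> ! k < \<sigma> ! c" if "k < a'" for k
    using not_less_Least [OF that [unfolded a'_def]] by simp
  then have "smaller_before \<sigma> a' \<subseteq> smaller_before \<sigma> c"
    using less by auto
  moreover have "b \<in> smaller_before \<sigma> c" "b \<notin> smaller_before \<sigma> a'"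
    using assms less by auto
  ultimately have "smaller_before \<sigma> a' \<subset> smaller_before \<sigma> c"
    by blast
  then have "Theta \<sigma> ! a' < Theta \<sigma> ! c"
    using less assms by (simp add: nth_Theta psubset_card_mono)
  with less ge show thesis
    using that by blast
qed

theorem theorem5p1:
  fixes \<sigma> :: "int list" and n :: nat
  assumes "length \<sigma> = n"
  shows "Theta \<sigma> \<in> FP n \<longleftrightarrow> avoids_101 \<sigma> \<and> avoids_201 \<sigma>"
proof -
  have "Theta \<sigma> \<in> FP n \<longleftrightarrow> Theta (Theta \<sigma>) = Theta \<sigma>"
    using assms Theta_in_inversion_sequences [of \<sigma>] by (simp add: FP_def)
  also have "\<dots> \<longleftrightarrow> avoids_101 \<sigma> \<and> avoids_201 \<sigma>"
  proof
    assume fixed: "Theta (Theta \<sigma>) = Theta \<sigma>"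
    show "avoids_101 \<sigma> \<and> avoids_201 \<sigma>"
      unfolding avoids_101_201_iff
    proof clarify
      fix a b c
      assume "a < b" "b < c" and c: "c < length \<sigma>" and "\<sigma> ! c \<le> \<sigma> ! a" "\<sigma> ! b < \<sigma> ! c"
      then obtain a' where "a' < c" "\<sigma> ! c \<le> \<sigma> ! a'" "Theta \<sigma> ! a' < Theta \<sigma> ! c"
        by (rule Theta_less_if_pattern)
      then show False
        using fixed c unfolding Theta_Theta_eq_iff by fastforce
    qed
  next
    assume "avoids_101 \<sigma> \<and> avoids_201 \<sigma>"
    then show "Theta (Theta \<sigma>) = Theta \<sigma>"
      by (simp add: Theta_Theta_eq_iff Theta_le_if_avoids)
  qed
  finally show ?thesis .
qed

end
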